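(* Let $n\ge2$ and suppose the noise satisfies (A4). Then for any constant $\delta^*>1/2$, any non-consensus initial state $x(1)\in\mathbb{R}^n$, and any (deterministic) gain sequence $\{a(t)\}_{t\ge1}$ with $a(t)\ge0$, there exists at least one topology sequence $\{\mathcal{G}(t)\}_{t\ge1}=\{(\mathcal{V},\mathcal{E}(t),\mathcal{A}(t))\}_{t\ge1}$ satisfying (A1) with $\delta=\delta^*$ and satisfying (A2), such that the system does not reach mean square consensus.
   Context: System. There are $n$ agents with scalar states $x_i(t)$, $t=1,2,\dots$, and deterministic initial state $x(1)\in\mathbb{R}^n$. At each time $t$ the topology is a weighted digraph $\mathcal{G}(t)=(\mathcal{V},\mathcal{E}(t),\mathcal{A}(t))$ without self-loops on $\mathcal{V}=\{1,\dots,n\}$; $\mathcal{N}_i(t)=\{j:(j,i)\in\mathcal{E}(t)\}$ is the neighbor set of $i$, and the edge $(j,i)$ has weight $a_{ij}^t$ with $1\le a_{ij}^t\le a_{\max}$ (standing assumption, $a_{\max}\ge 1$ a constant). The dynamics is $$x_i(t+1)=x_i(t)+a(t)\sum_{j\in\mathcal{N}_i(t)}a_{ij}^t\,[x_j(t)-x_i(t)+w_{ji}(t)],\qquad t\ge1,\ 1\le i\le n,$$ where $a(t)\ge0$ is the gain and $w_{ji}(t)$ are random noises. A state is non-consensus if its entries are not all equal. Mean square consensus: there is a random variable $x^*$ with $|E x^*|<\infty$, $\mathrm{Var}(x^* )<\infty$ and $\lim_{t\to\infty}E\|x(t)-x^*\mathbf{1}\|^2=0$ ($\mathbf 1$ is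 the all-ones vector, $\|\cdot\|$ the Euclidean norm). (A1) (extensible joint-connectivity): there exist constants $\delta\ge0$ (the extensible exponent) and $c\ge1$ and an infinite integer sequence $1=t_1<t_2<\cdots$ such that for all $k>1$, $t_k\le t_{k-1}+c\,t_{k-1}^{\delta}$ and the union graph $\bigcup_{t_{k-1}\le t<t_k}\mathcal{G}(t)$ (union of the edge sets) is strongly connected. (A2): for every $t\ge1$, $\mathcal{G}(t)$ is balanced, i.e. for every node $i$, $\sum_{j:(j,i)\in\mathcal{E}(t)}a_{ij}^t=\sum_{j:(i,j)\in\mathcal{E}(t)}a_{ji}^t$. (A4): there are constants $0<\underline v\le\overline v$ (independent of the topology sequence) such that for any topology sequence the noises $\{w_{ji}(t)\}$ are zero-mean random variables satisfying: (i) $E[w_{j_1i_1}(t_1)w_{j_2i_2}(t_2)]=0$ for all $t_1\ne t_2$, $(j_1,i_1)\in\mathcal{E}(t_1)$, $(j_2,i_2)\in\mathcal{E}(t_2)$; (ii) for any non-empty edge set $\mathcal{E}(t)$ and real numbers $\{c_{ji}\}$, $$\underline v\sum_{(j,i)\in\mathcal{E}(t)}c_{ji}^2\le E\Big[\sum_{(j,i)\in\mathcal{E}(t)}c_{ji}w_{ji}(t)\Big]^2\le\overline v\sum_{(j,i)\in\mathcal{E}(t)}c_{ji}^2 .$$ *)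

theory Defs
  imports "HOL-Probability.Probability"
begin

text \<open>
  The nodes are the elements of a finite type \<open>'n\<close>, so \<open>n = CARD('n)\<close>. An edge \<open>(j, i)\<close> goes from
  \<open>j\<close> to \<open>i\<close>, and its weight is \<open>weight g i j\<close>, in the order of the matrix entry \<open>a\<^sub>i\<^sub>j\<close>.
\<close>

record 'n wdigraph =
  edges :: "('n \<times> 'n) set"
  weight :: "'n \<Rightarrow> 'n \<Rightarrow> real"

definition neighbors :: "'n wdigraph \<Rightarrow> 'n \<Rightarrow> 'n set" where
  "neighbors g i = {j. (j, i) \<in> edges g}"

text \<open>Entries of the weight matrix that belong to no edge are normalised to \<open>0\<close>.\<close>

definition admissible_digraph :: "real \<Rightarrow> 'n wdigraph \<Rightarrow> bool" where
  "admissible_digraph a_max g \<longleftrightarrow>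
     (\<forall>i. (i, i) \<notin> edges g) \<and>
     (\<forall>j i. (j, i) \<in> edges g \<longrightarrow> 1 \<le> weight g i j \<and> weight g i j \<le> a_max) \<and>
     (\<forall>j i. (j, i) \<notin> edges g \<longrightarrow> weight g i j = 0)"

text \<open>Time starts at \<open>1\<close>; the value of a sequence at \<open>0\<close> plays no role.\<close>

definition topology_sequence :: "real \<Rightarrow> (nat \<Rightarrow> 'n wdigraph) \<Rightarrow> bool" where
  "topology_sequence a_max G \<longleftrightarrow> (\<forall>t\<ge>1. admissible_digraph a_max (G t))"

definition strongly_connected_edges :: "('n \<times> 'n) set \<Rightarrow> bool" where
  "strongly_connected_edges E \<longleftrightarrow> (\<forall>i j. (i, j) \<in> E\<^sup>*)"

definition extensible_joint_connectivity :: "real \<Rightarrow> (nat \<Rightarrow> 'n wdigraph) \<Rightarrow> bool" where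
  "extensible_joint_connectivity \<delta> G \<longleftrightarrow>
     0 \<le> \<delta> \<and>
     (\<exists>c::real. 1 \<le> c \<and>
       (\<exists>\<tau>::nat \<Rightarrow> nat. \<tau> 1 = 1 \<and> strict_mono_on {1..} \<tau> \<and>
         (\<forall>k>1. real (\<tau> k) \<le> real (\<tau> (k - 1)) + c * real (\<tau> (k - 1)) powr \<delta> \<and>
           strongly_connected_edges (\<Union>t\<in>{\<tau> (k - 1)..<\<tau> k}. edges (G t)))))"

definition balanced :: "'n::finite wdigraph \<Rightarrow> bool" where
  "balanced g \<longleftrightarrow>
     (\<forall>i. (\<Sum>j | (j, i) \<in> edges g. weight g i j) = (\<Sum>j | (i, j) \<in> edges g. weight g j i))"

text \<open>
  \<open>w j i t\<close> is the noise on edge \<open>(j, i)\<close> at time \<open>t\<close>; nothing is required of it when \<open>(j, i)\<close> is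
  not an edge at time \<open>t\<close>. Square integrability is part of the upper second-moment bound; it is
  stated separately because the Bochner integral of a non-integrable function is \<open>0\<close>.
\<close>

definition noise_condition ::
    "'w measure \<Rightarrow> real \<Rightarrow> real \<Rightarrow> (nat \<Rightarrow> 'n::finite wdigraph) \<Rightarrow>
      ('n \<Rightarrow> 'n \<Rightarrow> nat \<Rightarrow> 'w \<Rightarrow> real) \<Rightarrow> bool" where
  "noise_condition M v_lo v_hi G w \<longleftrightarrow>
     (\<forall>t\<ge>1. \<forall>(j, i)\<in>edges (G t).
        w j i t \<in> borel_measurable M \<and> integrable M (w j i t) \<and>
        integrable M (\<lambda>\<omega>. (w j i t \<omega>)\<^sup>2) \<and> (\<integral>\<omega>. w j i t \<omega> \<partial>M) = 0) \<and>
     (\<forall>s\<ge>1. \<forall>t\<ge>1. s \<noteq> t \<longrightarrow>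
        (\<forall>(j, i)\<in>edges (G s). \<forall>(l, k)\<in>edges (G t).
           (\<integral>\<omega>. w j i s \<omega> * w l k t \<omega> \<partial>M) = 0)) \<and>
     (\<forall>t\<ge>1. edges (G t) \<noteq> {} \<longrightarrow>
        (\<forall>c::'n \<Rightarrow> 'n \<Rightarrow> real.
           v_lo * (\<Sum>(j, i)\<in>edges (G t). (c j i)\<^sup>2)
             \<le> (\<integral>\<omega>. (\<Sum>(j, i)\<in>edges (G t). c j i * w j i t \<omega>)\<^sup>2 \<partial>M) \<and>
           (\<integral>\<omega>. (\<Sum>(j, i)\<in>edges (G t). c j i * w j i t \<omega>)\<^sup>2 \<partial>M)
             \<le> v_hi * (\<Sum>(j, i)\<in>edges (G t). (c j i)\<^sup>2)))"

text \<open>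
  The noise may depend on the topology sequence: \<open>W G\<close> is the noise under \<open>G\<close>. The two
  constants may not.
\<close>

definition uniform_noise_condition ::
    "'w measure \<Rightarrow> real \<Rightarrow>
      ((nat \<Rightarrow> 'n::finite wdigraph) \<Rightarrow> 'n \<Rightarrow> 'n \<Rightarrow> nat \<Rightarrow> 'w \<Rightarrow> real) \<Rightarrow> bool" where
  "uniform_noise_condition M a_max W \<longleftrightarrow>
     (\<exists>v_lo v_hi. 0 < v_lo \<and> v_lo \<le> v_hi \<and>
       (\<forall>G. topology_sequence a_max G \<longrightarrow> noise_condition M v_lo v_hi G (W G)))"

text \<open>The initial state is at time \<open>1\<close>; the value at time \<open>0\<close> is a dummy.\<close>

primrec state ::
    "(nat \<Rightarrow> real) \<Rightarrow> (nat \<Rightarrow> 'n::finite wdigraph) \<Rightarrow> ('n \<Rightarrow> 'n \<Rightarrow> nat \<Rightarrow> 'w \<Rightarrow> real) \<Rightarrow>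
      real ^ 'n \<Rightarrow> nat \<Rightarrow> 'w \<Rightarrow> real ^ 'n" where
  "state a G w x1 0 = (\<lambda>\<omega>. x1)"
| "state a G w x1 (Suc t) =
     (if t = 0 then (\<lambda>\<omega>. x1)
      else (\<lambda>\<omega>. \<chi> i. state a G w x1 t \<omega> $ i +
        a t * (\<Sum>j\<in>neighbors (G t) i. weight (G t) i j *
          (state a G w x1 t \<omega> $ j - state a G w x1 t \<omega> $ i + w j i t \<omega>))))"

definition consensus_state :: "real ^ 'n \<Rightarrow> bool" where
  "consensus_state x \<longleftrightarrow> (\<forall>i j. x $ i = x $ j)"

text \<open>
  The nonnegative integral gives the expectation of a squared norm its value \<open>\<infinity>\<close> when it
  diverges; \<open>1 :: real ^ 'n\<close> is the all-ones vector.
\<close>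

definition mean_square_consensus :: "'w measure \<Rightarrow> (nat \<Rightarrow> 'w \<Rightarrow> real ^ 'n::finite) \<Rightarrow> bool" where
  "mean_square_consensus M x \<longleftrightarrow>
     (\<exists>y::'w \<Rightarrow> real. y \<in> borel_measurable M \<and> integrable M y \<and>
        integrable M (\<lambda>\<omega>. (y \<omega> - (\<integral>\<omega>'. y \<omega>' \<partial>M))\<^sup>2) \<and>
        (\<lambda>t. \<integral>\<^sup>+\<omega>. ennreal ((norm (x t \<omega> - y \<omega> *\<^sub>R 1))\<^sup>2) \<partial>M) \<longlonglongrightarrow> 0)"

end

theory Submission
  imports Defs
begin

text \<open>
  The topology is either complete (all weights \<open>1\<close>) or empty, and the gains decide at which times
  it is complete. Such digraphs are balanced, and joint connectivity only requires one active time
  in each window of a suitable partition of the time axis.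

  If \<open>\<Sum> (a t)\<^sup>2 = \<infinity>\<close>, let the digraph be complete at all times. Interactions preserve the sum of the
  states, so this sum is a constant plus uncorrelated noise, with second moment at least a constant
  times \<open>\<Sum> (a t)\<^sup>2\<close>. It is unbounded, which rules out a limit of finite variance
  (\<open>no_consensus_complete_everywhere\<close>).

  If \<open>\<Sum> (a t)\<^sup>2 < \<infinity>\<close>, activate in the \<open>k\<close>-th window, of length \<open>L\<^sub>k\<close>, only a time \<open>m\<^sub>k\<close> at which the
  gain is least. By the inequality of arithmetic and geometric means
  \<open>2 a (m\<^sub>k) \<le> L\<^sub>k (a (m\<^sub>k))\<^sup>2 + 1 / L\<^sub>k\<close>, and the first term is at most the sum of \<open>(a t)\<^sup>2\<close> over the
  window. With windows of length about \<open>\<sigma>\<^sup>s\<close> from time \<open>\<sigma>\<close> on, where \<open>s > 1 / 2\<close>, also \<open>\<Sum> 1 / L\<^sub>k\<close>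
  converges; this is where the threshold \<open>1 / 2\<close> enters. So the gains at the active times have a
  finite sum (\<open>summable_gains_at_hitting_times\<close>). The difference of two states is multiplied by
  \<open>1 - n a\<close> at an active time and receives uncorrelated noise, so from some time on its second moment
  never falls below half of its value at that time (\<open>damped_recursion_bounded_below\<close>). Before that
  time a factor \<open>1 - n a\<close> may vanish, but then the noise of that same step, with \<open>a = 1 / n\<close>,
  restores a positive second moment. Hence the difference does not tend to \<open>0\<close> in mean square
  (\<open>no_consensus_summable_gains\<close>).
\<close>

section \<open>Windows with summable inverse lengths\<close>

primrec window_start :: "real \<Rightarrow> nat \<Rightarrow> nat" where
  "window_start s 0 = 1"
| "window_start s (Suc k) = window_start s k + nat \<lceil>real (window_start s k) powr s\<rceil>"

lemma window_start_ge_1: "window_start s k \<ge> 1"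
  by (induction k) auto

lemma strict_mono_window_start: "strict_mono (window_start s)"
proof (rule strict_monoI_Suc)
  fix k
  have "0 < real (window_start s k) powr s"
    using window_start_ge_1[of s k] by simp
  then show "window_start s k < window_start s (Suc k)" by simp
qed

lemma window_start_Suc_le:
  assumes "0 \<le> s" and "s \<le> \<delta>"
  shows "real (window_start s (Suc k)) \<le> real (window_start s k) + 2 * real (window_start s k) powr \<delta>"
proof -
  let ?x = "real (window_start s k)"
  have x: "1 \<le> ?x" using window_start_ge_1[of s k] by simp
  then have "1 \<le> ?x powr s" using assms by (simp add: ge_one_powr_ge_zero)
  moreover have "?x powr s \<le> ?x powr \<delta>" using x assms by (simp add: powr_mono)
  moreover have "real (nat \<lceil>?x powr s\<rceil>) \<le> ?x powr s + 1"
    using of_int_ceiling_le_add_one[of "?x powr s"] by simp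
  ultimately show ?thesis unfolding window_start.simps of_nat_add by linarith
qed

text \<open>
  The mean value theorem for \<open>u powr (- e)\<close>, with the derivative bounded by its value at the right end.
\<close>

lemma powr_decrease_ge:
  fixes x y e :: real
  assumes "0 < x" and "x \<le> y" and "0 < e"
  shows "e * (y - x) * y powr (- e - 1) \<le> x powr (- e) - y powr (- e)"
proof (cases "x = y")
  case False
  with assms have "x < y" by simp
  have "((\<lambda>u. u powr (- e)) has_real_derivative (- e) * u powr (- e - 1)) (at u)"
    if "x \<le> u" for u
    using that assms by (auto intro!: derivative_eq_intros)
  from MVT2[OF \<open>x < y\<close>, of "\<lambda>u. u powr (- e)" "\<lambda>u. (- e) * u powr (- e - 1)"] this
  obtain z where z: "x < z" "z < y"
    and eq: "y powr (- e) - x powr (- e) = (y - x) * ((- e) * z powr (- e - 1))"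
    by auto
  have "y powr (- e - 1) \<le> z powr (- e - 1)"
    using z assms by (intro powr_mono2') auto
  then have "e * (y - x) * y powr (- e - 1) \<le> e * (y - x) * z powr (- e - 1)"
    using assms by (intro mult_left_mono) auto
  with eq show ?thesis by (simp add: algebra_simps)
qed simp

text \<open>
  A telescoping bound: its right-hand sides sum to at most \<open>4 / (2 s - 1)\<close>. In a window that starts
  at \<open>\<sigma>\<close> and has length about \<open>\<sigma>\<^sup>s\<close>, the function \<open>u powr (1 - 2 s)\<close> has slope of order \<open>- \<sigma> powr (- 2 s)\<close>,
  so it drops by the order of \<open>\<sigma> powr (- s)\<close>, the inverse length. It decreases because \<open>s > 1 / 2\<close>; the
  bound \<open>s \<le> 1\<close> keeps all times of the window within a factor \<open>2\<close> of \<open>\<sigma>\<close>.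
\<close>

lemma inverse_window_length_le:
  assumes "1 / 2 < s" and "s \<le> 1"
  shows "1 / real (window_start s (Suc k) - window_start s k)
    \<le> 4 / (2 * s - 1) * (real (window_start s k) powr (1 - 2 * s)
        - real (window_start s (Suc k)) powr (1 - 2 * s))"
proof -
  define x L where "x = real (window_start s k)" and "L = real (nat \<lceil>x powr s\<rceil>)"
  have x: "1 \<le> x" using window_start_ge_1[of s k] by (simp add: x_def)
  have xs: "x powr s \<le> L" unfolding L_def by linarith
  have "x powr s \<le> x" using powr_mono[OF \<open>s \<le> 1\<close> x] x by simp
  then have "\<lceil>x powr s\<rceil> \<le> int (window_start s k)" by (simp add: x_def ceiling_le)
  then have "L \<le> x" unfolding L_def x_def by linarith
  have "0 < x powr s" using x by simp
  then have "0 < L" using xs by linarith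
  have pow: "(x + L) powr (- 2 * s) \<ge> 1 / (4 * L ^ 2)"
  proof -
    have "(x + L) powr (2 * s) \<le> (2 * x) powr (2 * s)"
      using \<open>L \<le> x\<close> \<open>0 < L\<close> x assms by (intro powr_mono2) auto
    also have "\<dots> = 2 powr (2 * s) * (x powr s) ^ 2"
      using x by (simp add: powr_mult powr_powr flip: powr_numeral) (simp add: mult.commute)
    also have "\<dots> \<le> 2 powr 2 * L ^ 2"
      using xs assms by (intro mult_mono powr_mono power_mono) auto
    finally have "(x + L) powr (2 * s) \<le> 4 * L ^ 2" by simp
    moreover have "0 < (x + L) powr (2 * s)" using x \<open>0 < L\<close> by simp
    ultimately have "1 / (4 * L ^ 2) \<le> 1 / (x + L) powr (2 * s)"
      using \<open>0 < L\<close> by (intro divide_left_mono mult_pos_pos) auto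
    then show ?thesis using powr_minus_divide[of "x + L" "2 * s"] by simp
  qed
  have "(2 * s - 1) * L * (1 / (4 * L ^ 2)) \<le> (2 * s - 1) * L * (x + L) powr (- 2 * s)"
    using pow assms \<open>0 < L\<close> by (intro mult_left_mono) auto
  also have "\<dots> \<le> x powr (1 - 2 * s) - (x + L) powr (1 - 2 * s)"
    using powr_decrease_ge[of x "x + L" "2 * s - 1"] x \<open>0 < L\<close> assms by simp
  also have "(2 * s - 1) * L * (1 / (4 * L ^ 2)) = (2 * s - 1) / 4 * (1 / L)"
    using \<open>0 < L\<close> by (simp add: power2_eq_square)
  finally have "4 / (2 * s - 1) * ((2 * s - 1) / 4 * (1 / L))
      \<le> 4 / (2 * s - 1) * (x powr (1 - 2 * s) - (x + L) powr (1 - 2 * s))"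
    using assms by (intro mult_left_mono) auto
  moreover have "4 / e * (e / 4 * r) = r" if "e \<noteq> 0" for e r :: real
    using that by simp
  from this[of "2 * s - 1" "1 / L"] have "4 / (2 * s - 1) * ((2 * s - 1) / 4 * (1 / L)) = 1 / L"
    using assms by linarith
  ultimately have "1 / L \<le> 4 / (2 * s - 1) * (x powr (1 - 2 * s) - (x + L) powr (1 - 2 * s))"
    by simp
  then show ?thesis by (simp add: x_def L_def)
qed

declare window_start.simps(2) [simp del]

section \<open>Digraphs that are complete at selected times\<close>

definition complete_digraph :: "'n wdigraph" where
  "complete_digraph = \<lparr>edges = {(j, i). j \<noteq> i}, weight = (\<lambda>i j. if i = j then 0 else 1)\<rparr>"

definition empty_digraph :: "'n wdigraph" where
  "empty_digraph = \<lparr>edges = {}, weight = (\<lambda>i j. 0)\<rparr>"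

definition complete_at :: "nat set \<Rightarrow> nat \<Rightarrow> 'n wdigraph" where
  "complete_at A t = (if t \<in> A then complete_digraph else empty_digraph)"

lemma topology_sequence_complete_at:
  "1 \<le> a_max \<Longrightarrow> topology_sequence a_max (complete_at A)"
  by (auto simp: topology_sequence_def admissible_digraph_def complete_at_def
      complete_digraph_def empty_digraph_def)

lemma balanced_complete_at: "balanced (complete_at A t)"
proof -
  have "card {j. j \<noteq> i} = card {j. i \<noteq> j}" for i :: 'a
    by (rule arg_cong[of _ _ card]) auto
  then show ?thesis
    by (auto simp: balanced_def complete_at_def complete_digraph_def empty_digraph_def intro!: sum.cong)
qed

lemma extensible_joint_connectivity_complete_at:
  assumes "0 \<le> s" and "s \<le> \<delta>"
    and hit: "\<And>k. \<exists>t\<in>A. window_start s k \<le> t \<and> t < window_start s (Suc k)"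
  shows "extensible_joint_connectivity \<delta> (complete_at A)"
  unfolding extensible_joint_connectivity_def
proof (intro conjI exI[of _ 2] exI[of _ "\<lambda>k. window_start s (k - 1)"] allI impI)
  show "strict_mono_on {1..} (\<lambda>k. window_start s (k - 1))"
    by (auto intro!: strict_mono_onI strict_monoD[OF strict_mono_window_start])
next
  fix k :: nat assume "1 < k"
  then obtain l where k: "k = Suc (Suc l)" by (metis less_imp_Suc_add plus_1_eq_Suc add.commute add_Suc)
  show "real (window_start s (k - 1))
      \<le> real (window_start s (k - 1 - 1)) + 2 * real (window_start s (k - 1 - 1)) powr \<delta>"
    using window_start_Suc_le[OF assms(1,2), of l] by (simp add: k)
  obtain t where t: "t \<in> A" "window_start s l \<le> t" "t < window_start s (Suc l)"
    using hit by blast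
  have "(i, j) \<in> (\<Union>t\<in>{window_start s l..<window_start s (Suc l)}.
      edges (complete_at A t :: 'a wdigraph))\<^sup>*" for i j
  proof (cases "i = j")
    case False
    then have "(i, j) \<in> edges (complete_at A t :: 'a wdigraph)"
      using t by (simp add: complete_at_def complete_digraph_def)
    then show ?thesis using t by (intro r_into_rtrancl) auto
  qed simp
  then show "strongly_connected_edges
      (\<Union>t\<in>{window_start s (k - 1 - 1)..<window_start s (k - 1)}. edges (complete_at A t :: 'a wdigraph))"
    unfolding strongly_connected_edges_def k by simp
qed (use assms in auto)

section \<open>Active times with summable gains\<close>

text \<open>
  The least gain of a window is bounded by half the sum of the squared gains over the window plus
  half its inverse length, and both of these are summable over the windows.
\<close>

lemma summable_gains_at_hitting_times:
  fixes a :: "nat \<Rightarrow> real"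
  assumes s: "1 / 2 < s" "s \<le> 1"
    and a: "\<And>t. 1 \<le> t \<Longrightarrow> 0 \<le> a t"
    and sq: "summable (\<lambda>t. (a t)\<^sup>2)"
  shows "\<exists>A. (\<forall>k. \<exists>t\<in>A. window_start s k \<le> t \<and> t < window_start s (Suc k)) \<and>
    summable (\<lambda>t. if t \<in> A then a t else 0)"
proof -
  let ?\<sigma> = "window_start s"
  let ?W = "\<lambda>k. {?\<sigma> k..<?\<sigma> (Suc k)}"
  have less: "?\<sigma> k < ?\<sigma> (Suc k)" for k
    by (rule strict_monoD[OF strict_mono_window_start]) simp
  have "\<exists>t\<in>?W k. \<forall>r\<in>?W k. a t \<le> a r" for k
    using ex_is_arg_min_if_finite[of "?W k" a] less[of k] by (fastforce simp: is_arg_min_linorder)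
  then obtain m where m: "\<And>k. m k \<in> ?W k" and min: "\<And>k r. r \<in> ?W k \<Longrightarrow> a (m k) \<le> a r"
    by metis
  define A where "A = range m"
  let ?b = "\<lambda>t. if t \<in> A then a t else 0"
  have disjoint: "k = l" if "t \<in> ?W k" "t \<in> ?W l" for t k l
  proof -
    have "\<not> k < l" if "t \<in> ?W k" "t \<in> ?W l" for k l
    proof
      assume "k < l"
      then have "?\<sigma> (Suc k) \<le> ?\<sigma> l"
        by (intro monoD[OF strict_mono_mono[OF strict_mono_window_start]]) simp
      with that show False by auto
    qed
    with that show ?thesis by (metis linorder_neqE_nat)
  qed
  have AW: "A \<inter> ?W k = {m k}" for k
  proof (intro equalityI subsetI)
    fix t assume "t \<in> A \<inter> ?W k"
    then obtain l where "t = m l" "m l \<in> ?W k" by (auto simp: A_def)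
    with disjoint[OF m[of l], of k] show "t \<in> {m k}" by simp
  qed (use m in \<open>auto simp: A_def\<close>)
  have one: "1 \<le> m k" for k using m[of k] window_start_ge_1[of s k] by simp
  have in_window: "sum ?b (?W k) \<le> ((\<Sum>t\<in>?W k. (a t)\<^sup>2) + 1 / real (?\<sigma> (Suc k) - ?\<sigma> k)) / 2" for k
  proof -
    define L where "L = real (?\<sigma> (Suc k) - ?\<sigma> k)"
    have "0 < L" using less[of k] by (simp add: L_def)
    have "sum ?b (?W k) = sum a (?W k \<inter> A)"
      by (simp add: sum.inter_restrict)
    also have "\<dots> = a (m k)" using AW[of k] by (simp add: Int_commute)
    also have "\<dots> \<le> (L * (a (m k))\<^sup>2 + 1 / L) / 2"
    proof -
      have "0 \<le> (L * a (m k) - 1)\<^sup>2 / L" using \<open>0 < L\<close> by simp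
      also have "\<dots> = L * (a (m k))\<^sup>2 + 1 / L - 2 * a (m k)"
        using \<open>0 < L\<close> by (simp add: field_simps power2_eq_square)
      finally show ?thesis by simp
    qed
    also have "L * (a (m k))\<^sup>2 \<le> (\<Sum>t\<in>?W k. (a t)\<^sup>2)"
    proof -
      have "(a (m k))\<^sup>2 \<le> (a t)\<^sup>2" if "t \<in> ?W k" for t
        using min[OF that] a[OF one] by (simp add: power_mono)
      then have "(\<Sum>t\<in>?W k. (a (m k))\<^sup>2) \<le> (\<Sum>t\<in>?W k. (a t)\<^sup>2)" by (rule sum_mono)
      then show ?thesis by (simp add: L_def)
    qed
    finally show ?thesis by (simp add: L_def)
  qed
  define C where "C = 4 / (2 * s - 1)"
  have "0 < C" using s by (simp add: C_def)
  have upto_window: "sum ?b {1..<?\<sigma> k}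
      \<le> ((\<Sum>t\<in>{1..<?\<sigma> k}. (a t)\<^sup>2) + C * (1 - real (?\<sigma> k) powr (1 - 2 * s))) / 2" for k
  proof (induction k)
    case (Suc k)
    have split: "sum f {1..<?\<sigma> (Suc k)} = sum f {1..<?\<sigma> k} + sum f (?W k)" for f :: "nat \<Rightarrow> real"
      using less[of k] window_start_ge_1[of s k]
      by (intro sum.atLeastLessThan_concat[symmetric]) auto
    show ?case
      using Suc in_window[of k] inverse_window_length_le[OF s, of k]
      unfolding split C_def[symmetric] by (simp add: algebra_simps)
  qed simp
  have "sum ?b {1..<N} \<le> (suminf (\<lambda>t. (a t)\<^sup>2) + C) / 2" for N
  proof -
    have "N \<le> ?\<sigma> N" using strict_mono_imp_increasing[OF strict_mono_window_start] .
    then have "sum ?b {1..<N} \<le> sum ?b {1..<?\<sigma> N}"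
      by (intro sum_mono2) (auto simp: a)
    also have "\<dots> \<le> ((\<Sum>t\<in>{1..<?\<sigma> N}. (a t)\<^sup>2) + C * (1 - real (?\<sigma> N) powr (1 - 2 * s))) / 2"
      by (rule upto_window)
    also have "(\<Sum>t\<in>{1..<?\<sigma> N}. (a t)\<^sup>2) \<le> suminf (\<lambda>t. (a t)\<^sup>2)"
      by (intro sum_le_suminf sq) auto
    also have "C * (1 - real (?\<sigma> N) powr (1 - 2 * s)) \<le> C"
      using \<open>0 < C\<close> by (simp add: algebra_simps)
    finally show ?thesis by simp
  qed
  then have bound: "sum (\<lambda>t. ?b (Suc t)) {..<N} \<le> (suminf (\<lambda>t. (a t)\<^sup>2) + C) / 2" for N
    using sum.shift_bounds_Suc_ivl[of ?b 0 N] by (metis One_nat_def lessThan_atLeast0)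
  have "summable (\<lambda>t. ?b (Suc t))"
    by (rule summableI_nonneg_bounded[OF _ bound]) (simp add: a)
  then have "summable ?b" using summable_Suc_iff[of ?b] by blast
  moreover have "\<exists>t\<in>A. ?\<sigma> k \<le> t \<and> t < ?\<sigma> (Suc k)" for k
    using m[of k] unfolding A_def by auto
  ultimately show ?thesis by (intro exI[of _ A] conjI allI)
qed

section \<open>Scalar recursions driven by orthogonal noise\<close>

definition square_integrable :: "'w measure \<Rightarrow> ('w \<Rightarrow> real) \<Rightarrow> bool" where
  "square_integrable M f \<longleftrightarrow> f \<in> borel_measurable M \<and> integrable M (\<lambda>\<omega>. (f \<omega>)\<^sup>2)"

lemma square_integrable_imp_integrable_mult:
  assumes "square_integrable M f" and "square_integrable M g"
  shows "integrable M (\<lambda>\<omega>. f \<omega> * g \<omega>)"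
proof (rule Bochner_Integration.integrable_bound)
  show "integrable M (\<lambda>\<omega>. (f \<omega>)\<^sup>2 + (g \<omega>)\<^sup>2)"
    using assms by (simp add: square_integrable_def)
  show "(\<lambda>\<omega>. f \<omega> * g \<omega>) \<in> borel_measurable M"
    using assms by (auto simp: square_integrable_def)
  have "\<bar>u * v\<bar> \<le> u\<^sup>2 + v\<^sup>2" for u v :: real
  proof -
    have "0 \<le> (\<bar>u\<bar> - \<bar>v\<bar>)\<^sup>2" by simp
    then have "2 * \<bar>u * v\<bar> \<le> u\<^sup>2 + v\<^sup>2" by (simp add: power2_diff abs_mult)
    then show ?thesis using abs_ge_zero[of "u * v"] by linarith
  qed
  then show "AE \<omega> in M. norm (f \<omega> * g \<omega>) \<le> norm ((f \<omega>)\<^sup>2 + (g \<omega>)\<^sup>2)" by simp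
qed

lemma square_integrable_cmult:
  "square_integrable M f \<Longrightarrow> square_integrable M (\<lambda>\<omega>. r * f \<omega>)"
  by (auto simp: square_integrable_def power_mult_distrib)

lemma square_integrable_add:
  assumes f: "square_integrable M f" and g: "square_integrable M g"
  shows "square_integrable M (\<lambda>\<omega>. f \<omega> + g \<omega>)"
  using assms square_integrable_imp_integrable_mult[OF f g]
  by (auto simp: square_integrable_def power2_sum mult.assoc)

lemma square_integrable_sum:
  assumes "finite I" and "\<And>i. i \<in> I \<Longrightarrow> square_integrable M (f i)"
  shows "square_integrable M (\<lambda>\<omega>. \<Sum>i\<in>I. f i \<omega>)"
  using assms by (induction I) (auto intro: square_integrable_add simp: square_integrable_def[of _ "\<lambda>\<omega>. 0"])

text \<open>
  Orthogonality of the noise in time, in place of independence, already makes \<open>z t\<close> orthogonal to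
  the present and later noise: \<open>z t\<close> is a constant plus a linear combination of earlier noise terms.
  So the second moments obey a closed recursion.
\<close>

locale orthogonal_noise_recursion = prob_space M for M :: "'w measure" +
  fixes z \<xi> :: "nat \<Rightarrow> 'w \<Rightarrow> real" and \<rho> b :: "nat \<Rightarrow> real" and z1 :: real
  assumes initial: "\<And>\<omega>. z 1 \<omega> = z1"
    and recursion: "\<And>t \<omega>. 1 \<le> t \<Longrightarrow> z (Suc t) \<omega> = \<rho> t * z t \<omega> + b t * \<xi> t \<omega>"
    and noise_square_integrable: "\<And>t. 1 \<le> t \<Longrightarrow> square_integrable M (\<xi> t)"
    and noise_centered: "\<And>t. 1 \<le> t \<Longrightarrow> expectation (\<xi> t) = 0"
    and noise_orthogonal: "\<And>s t. 1 \<le> s \<Longrightarrow> 1 \<le> t \<Longrightarrow> s \<noteq> t \<Longrightarrow> expectation (\<lambda>\<omega>. \<xi> s \<omega> * \<xi> t \<omega>) = 0"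
begin

lemma z_square_integrable: "1 \<le> t \<Longrightarrow> square_integrable M (z t)"
proof (induction t rule: dec_induct)
  case base
  have "z 1 = (\<lambda>\<omega>. z1)" using initial by (rule ext)
  then show ?case by (simp add: square_integrable_def)
next
  case (step t)
  have "z (Suc t) = (\<lambda>\<omega>. \<rho> t * z t \<omega> + b t * \<xi> t \<omega>)"
    using recursion[OF step.hyps(1)] by (rule ext)
  then show ?case
    using step noise_square_integrable by (auto intro!: square_integrable_add square_integrable_cmult)
qed

lemma z_orthogonal_later_noise: "1 \<le> t \<Longrightarrow> t \<le> r \<Longrightarrow> expectation (\<lambda>\<omega>. z t \<omega> * \<xi> r \<omega>) = 0"
proof (induction t rule: dec_induct)
  case base
  then show ?case using noise_centered[of r] unfolding initial by simp
next
  case (step t)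
  have "(\<lambda>\<omega>. z (Suc t) \<omega> * \<xi> r \<omega>)
      = (\<lambda>\<omega>. \<rho> t * (z t \<omega> * \<xi> r \<omega>) + b t * (\<xi> t \<omega> * \<xi> r \<omega>))"
    using recursion[OF step.hyps(1)] by (simp add: algebra_simps)
  moreover have "integrable M (\<lambda>\<omega>. z t \<omega> * \<xi> r \<omega>)" "integrable M (\<lambda>\<omega>. \<xi> t \<omega> * \<xi> r \<omega>)"
    using step by (auto intro!: square_integrable_imp_integrable_mult z_square_integrable noise_square_integrable)
  ultimately show ?case
    using step noise_orthogonal[of t r] by simp
qed

lemma second_moment_Suc:
  assumes "1 \<le> t"
  shows "expectation (\<lambda>\<omega>. (z (Suc t) \<omega>)\<^sup>2)
    = (\<rho> t)\<^sup>2 * expectation (\<lambda>\<omega>. (z t \<omega>)\<^sup>2) + (b t)\<^sup>2 * expectation (\<lambda>\<omega>. (\<xi> t \<omega>)\<^sup>2)"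
proof -
  have "(\<lambda>\<omega>. (z (Suc t) \<omega>)\<^sup>2) = (\<lambda>\<omega>. (\<rho> t)\<^sup>2 * (z t \<omega>)\<^sup>2 + (b t)\<^sup>2 * (\<xi> t \<omega>)\<^sup>2
      + 2 * \<rho> t * b t * (z t \<omega> * \<xi> t \<omega>))"
    using recursion[OF assms] by (simp add: power2_sum power_mult_distrib algebra_simps)
  moreover have "integrable M (\<lambda>\<omega>. (z t \<omega>)\<^sup>2)" "integrable M (\<lambda>\<omega>. (\<xi> t \<omega>)\<^sup>2)"
    "integrable M (\<lambda>\<omega>. z t \<omega> * \<xi> t \<omega>)"
    using z_square_integrable[OF assms] noise_square_integrable[OF assms]
    by (auto simp: square_integrable_def[of M] intro: square_integrable_imp_integrable_mult)
  ultimately show ?thesis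
    using z_orthogonal_later_noise[OF assms order_refl] by simp
qed

end

section \<open>The noise seen by a linear functional of the state\<close>

text \<open>
  The noise term of \<open>c \<bullet> x\<close> in a digraph with unit weights: the noise on \<open>(j, i)\<close> acts on node \<open>i\<close>.
\<close>

definition edge_noise ::
    "(nat \<Rightarrow> 'n::finite wdigraph) \<Rightarrow> ('n \<Rightarrow> 'n \<Rightarrow> nat \<Rightarrow> 'w \<Rightarrow> real) \<Rightarrow> real ^ 'n \<Rightarrow> nat \<Rightarrow> 'w \<Rightarrow> real" where
  "edge_noise G w c t \<omega> = (\<Sum>(j, i)\<in>edges (G t). c $ i * w j i t \<omega>)"

context
  fixes M :: "'w measure" and v_lo v_hi :: real and G :: "nat \<Rightarrow> 'n::finite wdigraph"
    and w :: "'n \<Rightarrow> 'n \<Rightarrow> nat \<Rightarrow> 'w \<Rightarrow> real"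
  assumes noise: "noise_condition M v_lo v_hi G w"
begin

lemma noise_on_edge_square_integrable:
  "1 \<le> t \<Longrightarrow> (j, i) \<in> edges (G t) \<Longrightarrow> square_integrable M (w j i t)"
  using noise by (auto simp: noise_condition_def square_integrable_def)

lemma edge_noise_square_integrable:
  assumes "1 \<le> t"
  shows "square_integrable M (edge_noise G w c t)"
proof -
  have "square_integrable M (\<lambda>\<omega>. \<Sum>p\<in>edges (G t). c $ snd p * w (fst p) (snd p) t \<omega>)"
    using noise_on_edge_square_integrable[OF assms]
    by (intro square_integrable_sum square_integrable_cmult) auto
  then show ?thesis by (simp add: edge_noise_def[abs_def] case_prod_unfold)
qed

lemma edge_noise_centered:
  assumes "1 \<le> t"
  shows "(\<integral>\<omega>. edge_noise G w c t \<omega> \<partial>M) = 0"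
proof -
  have "integrable M (w (fst p) (snd p) t) \<and> (\<integral>\<omega>. w (fst p) (snd p) t \<omega> \<partial>M) = 0"
    if "p \<in> edges (G t)" for p
    using noise assms that by (cases p) (auto simp: noise_condition_def)
  then show ?thesis
    by (simp add: edge_noise_def case_prod_unfold)
qed

lemma edge_noise_orthogonal:
  assumes "1 \<le> s" and "1 \<le> t" and "s \<noteq> t"
  shows "(\<integral>\<omega>. edge_noise G w c s \<omega> * edge_noise G w c t \<omega> \<partial>M) = 0"
proof -
  have zero: "(\<integral>\<omega>. w (fst p) (snd p) s \<omega> * w (fst q) (snd q) t \<omega> \<partial>M) = 0"
    if "p \<in> edges (G s)" "q \<in> edges (G t)" for p q
    using noise assms that unfolding noise_condition_def by (cases p, cases q) fastforce
  have int: "integrable M (\<lambda>\<omega>. w (fst p) (snd p) s \<omega> * w (fst q) (snd q) t \<omega>)"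
    if "p \<in> edges (G s)" "q \<in> edges (G t)" for p q
    using assms that by (intro square_integrable_imp_integrable_mult noise_on_edge_square_integrable) auto
  have "(\<lambda>\<omega>. edge_noise G w c s \<omega> * edge_noise G w c t \<omega>) = (\<lambda>\<omega>. \<Sum>p\<in>edges (G s). \<Sum>q\<in>edges (G t).
      c $ snd p * c $ snd q * (w (fst p) (snd p) s \<omega> * w (fst q) (snd q) t \<omega>))"
    by (simp add: edge_noise_def case_prod_unfold sum_product algebra_simps)
  then show ?thesis
    using int zero by (simp add: Bochner_Integration.integral_sum)
qed

lemma edge_noise_second_moment_ge:
  assumes "1 \<le> t"
  shows "v_lo * (\<Sum>(j, i)\<in>edges (G t). (c $ i)\<^sup>2) \<le> (\<integral>\<omega>. (edge_noise G w c t \<omega>)\<^sup>2 \<partial>M)"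
proof (cases "edges (G t) = {}")
  case False
  then show ?thesis
    using noise assms unfolding noise_condition_def edge_noise_def
    by (auto dest!: spec[where x = t] spec[where x = "\<lambda>j i. c $ i"])
qed (simp add: edge_noise_def)

end

section \<open>Consequences of consensus and of small total gain\<close>

text \<open>
  Near consensus \<open>c \<bullet> x\<close> is close to \<open>(c \<bullet> 1) y\<close> in mean square, by the Cauchy-Schwarz inequality.
  So its second moment is eventually bounded, and it tends to \<open>0\<close> if \<open>c \<bullet> 1 = 0\<close>: both uses are
  covered by keeping the factor \<open>(c \<bullet> 1)\<^sup>2\<close> apart from \<open>B\<close>.
\<close>

lemma mean_square_consensus_bounds_inner:
  fixes x :: "nat \<Rightarrow> 'w \<Rightarrow> real ^ 'n::finite" and c :: "real ^ 'n"
  assumes "prob_space M" and "mean_square_consensus M x" and "c \<noteq> 0"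
    and z: "\<And>t. 1 \<le> t \<Longrightarrow> square_integrable M (\<lambda>\<omega>. c \<bullet> x t \<omega>)"
  obtains B where
    "\<And>\<epsilon>. 0 < \<epsilon> \<Longrightarrow> eventually (\<lambda>t. (\<integral>\<omega>. (c \<bullet> x t \<omega>)\<^sup>2 \<partial>M) \<le> (c \<bullet> 1)\<^sup>2 * B + \<epsilon>) sequentially"
proof -
  interpret prob_space M by fact
  from assms(2) obtain y where ym: "y \<in> borel_measurable M" "integrable M y"
    and var: "integrable M (\<lambda>\<omega>. (y \<omega> - expectation y)\<^sup>2)"
    and lim: "(\<lambda>t. \<integral>\<^sup>+\<omega>. ennreal ((norm (x t \<omega> - y \<omega> *\<^sub>R 1))\<^sup>2) \<partial>M) \<longlonglongrightarrow> 0"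
    by (auto simp: mean_square_consensus_def)
  have "square_integrable M (\<lambda>\<omega>. (y \<omega> - expectation y) + expectation y)"
    by (rule square_integrable_add) (use ym var in \<open>auto simp: square_integrable_def\<close>)
  then have y: "square_integrable M y" by simp
  define \<gamma> where "\<gamma> = c \<bullet> (1 :: real ^ 'n)"
  define K where "K = (norm c)\<^sup>2"
  have "0 < K" using \<open>c \<noteq> 0\<close> by (simp add: K_def)
  show thesis
  proof (rule that[of "2 * expectation (\<lambda>\<omega>. (y \<omega>)\<^sup>2)"])
    fix \<epsilon> :: real assume "0 < \<epsilon>"
    have "eventually (\<lambda>t. (\<integral>\<^sup>+\<omega>. ennreal ((norm (x t \<omega> - y \<omega> *\<^sub>R 1))\<^sup>2) \<partial>M) < ennreal (\<epsilon> / (2 * K)))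
        sequentially"
      using \<open>0 < \<epsilon>\<close> \<open>0 < K\<close> by (intro order_tendstoD(2)[OF lim]) simp
    moreover have "eventually (\<lambda>t. 1 \<le> t) sequentially" by (rule eventually_ge_at_top)
    ultimately show "eventually (\<lambda>t. (\<integral>\<omega>. (c \<bullet> x t \<omega>)\<^sup>2 \<partial>M)
        \<le> (c \<bullet> 1)\<^sup>2 * (2 * expectation (\<lambda>\<omega>. (y \<omega>)\<^sup>2)) + \<epsilon>) sequentially"
    proof eventually_elim
      case (elim t)
      let ?d = "\<lambda>\<omega>. c \<bullet> x t \<omega> + (- \<gamma>) * y \<omega>"
      have d: "square_integrable M ?d"
        by (intro square_integrable_add square_integrable_cmult z y elim)
      then have di: "integrable M (\<lambda>\<omega>. (?d \<omega>)\<^sup>2)" by (simp add: square_integrable_def)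
      have le: "(?d \<omega>)\<^sup>2 / K \<le> (norm (x t \<omega> - y \<omega> *\<^sub>R 1))\<^sup>2" for \<omega>
      proof -
        have "?d \<omega> = c \<bullet> (x t \<omega> - y \<omega> *\<^sub>R 1)"
          by (simp add: \<gamma>_def inner_diff_right)
        then have "\<bar>?d \<omega>\<bar> \<le> norm c * norm (x t \<omega> - y \<omega> *\<^sub>R 1)"
          using Cauchy_Schwarz_ineq2 by metis
        from power_mono[OF this, of 2] have "(?d \<omega>)\<^sup>2 \<le> (norm c * norm (x t \<omega> - y \<omega> *\<^sub>R 1))\<^sup>2"
          by (simp only: power2_abs abs_ge_zero)
        then show ?thesis
          using \<open>0 < K\<close> by (simp add: K_def power_mult_distrib field_simps)
      qed
      \<comment> \<open>The bound \<open>le\<close> has the factor \<open>1 / K\<close> on the measurable side, so that monotonicity of the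
        integral applies without measurability of \<open>x t\<close>.\<close>
      have "ennreal (expectation (\<lambda>\<omega>. (?d \<omega>)\<^sup>2 / K)) = (\<integral>\<^sup>+\<omega>. ennreal ((?d \<omega>)\<^sup>2 / K) \<partial>M)"
        using di \<open>0 < K\<close> by (subst nn_integral_eq_integral) auto
      also have "\<dots> \<le> (\<integral>\<^sup>+\<omega>. ennreal ((norm (x t \<omega> - y \<omega> *\<^sub>R 1))\<^sup>2) \<partial>M)"
        using le by (intro nn_integral_mono ennreal_leI)
      also have "\<dots> < ennreal (\<epsilon> / (2 * K))" by (rule elim)
      finally have "expectation (\<lambda>\<omega>. (?d \<omega>)\<^sup>2) / K < \<epsilon> / (2 * K)"
        using \<open>0 < K\<close> by (subst (asm) ennreal_less_iff) auto
      then have small: "expectation (\<lambda>\<omega>. (?d \<omega>)\<^sup>2) < \<epsilon> / 2"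
        using \<open>0 < K\<close> by (simp add: field_simps)
      have "(c \<bullet> x t \<omega>)\<^sup>2 \<le> 2 * (?d \<omega>)\<^sup>2 + 2 * \<gamma>\<^sup>2 * (y \<omega>)\<^sup>2" for \<omega>
      proof -
        have "(p + q)\<^sup>2 \<le> 2 * p\<^sup>2 + 2 * q\<^sup>2" for p q :: real
          using zero_le_power2[of "p - q"] by (simp add: power2_sum power2_diff)
        from this[of "?d \<omega>" "\<gamma> * y \<omega>"] show ?thesis by (simp add: power_mult_distrib)
      qed
      then have "expectation (\<lambda>\<omega>. (c \<bullet> x t \<omega>)\<^sup>2)
          \<le> expectation (\<lambda>\<omega>. 2 * (?d \<omega>)\<^sup>2 + 2 * \<gamma>\<^sup>2 * (y \<omega>)\<^sup>2)"
        using z[of t] y di elim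
        by (intro integral_mono) (auto simp: square_integrable_def)
      also have "\<dots> = 2 * expectation (\<lambda>\<omega>. (?d \<omega>)\<^sup>2) + 2 * \<gamma>\<^sup>2 * expectation (\<lambda>\<omega>. (y \<omega>)\<^sup>2)"
        using y di by (subst Bochner_Integration.integral_add) (auto simp: square_integrable_def)
      finally show ?case using small by (simp add: \<gamma>_def algebra_simps)
    qed
  qed
qed

text \<open>
  Positivity persists: the damping factor vanishes only if \<open>b t = 1 / N\<close>, and then the noise term is
  positive. Once the tail sum of \<open>2 N b\<close> is below \<open>1 / 2\<close>, the inequality
  \<open>\<Prod> (1 - 2 N b t) \<ge> 1 - \<Sum> 2 N b t\<close> keeps \<open>u\<close> above half of its value at the start of the tail.
\<close>

lemma damped_recursion_bounded_below:
  fixes u b q :: "nat \<Rightarrow> real"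
  assumes "0 < u 1" and "0 \<le> N" and b: "\<And>t. 1 \<le> t \<Longrightarrow> 0 \<le> b t" and "summable b"
    and q: "\<And>t. 1 \<le> t \<Longrightarrow> 0 \<le> q t" "\<And>t. 1 \<le> t \<Longrightarrow> b t \<noteq> 0 \<Longrightarrow> 0 < q t"
    and recursion: "\<And>t. 1 \<le> t \<Longrightarrow> u (Suc t) = (1 - N * b t)\<^sup>2 * u t + (b t)\<^sup>2 * q t"
  obtains \<epsilon> where "0 < \<epsilon>" and "eventually (\<lambda>t. \<epsilon> \<le> u t) sequentially"
proof -
  have pos: "0 < u t" if "1 \<le> t" for t
    using that
  proof (induction t rule: dec_induct)
    case (step t)
    have "0 < (1 - N * b t)\<^sup>2 * u t \<or> 0 < (b t)\<^sup>2 * q t"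
      using step q(2)[of t] by (cases "b t = 0") (auto simp: zero_less_mult_iff)
    moreover have "0 \<le> (1 - N * b t)\<^sup>2 * u t" "0 \<le> (b t)\<^sup>2 * q t"
      using step q(1)[of t] by auto
    ultimately show ?case using recursion[OF step.hyps(1)] by linarith
  qed (rule assms)
  have "summable (\<lambda>t. 2 * N * b t)" using \<open>summable b\<close> by (intro summable_mult)
  from this[unfolded summable_Cauchy, rule_format, of "1 / 2"] obtain T0
    where T0: "\<And>m n. T0 \<le> m \<Longrightarrow> norm (sum (\<lambda>t. 2 * N * b t) {m..<n}) < 1 / 2" by auto
  define T where "T = max 1 T0"
  have T: "1 \<le> T" "T0 \<le> T" by (auto simp: T_def)
  let ?S = "\<lambda>t. sum (\<lambda>r. 2 * N * b r) {T..<t}"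
  have half: "?S t < 1 / 2" for t using T0[OF T(2), of t] by auto
  have "(1 - ?S t) * u T \<le> u t" if "T \<le> t" for t
    using that
  proof (induction t rule: dec_induct)
    case (step t)
    then have "1 \<le> t" using T by simp
    have nonneg: "0 \<le> 2 * N * b t" using b[OF \<open>1 \<le> t\<close>] \<open>0 \<le> N\<close> by simp
    have "0 \<le> ?S t" using b T \<open>0 \<le> N\<close> by (intro sum_nonneg) auto
    have S: "?S (Suc t) = ?S t + 2 * N * b t" using step by simp
    have "2 * N * b t < 1 / 2" using half[of "Suc t"] \<open>0 \<le> ?S t\<close> S by linarith
    have "1 - ?S (Suc t) \<le> (1 - 2 * N * b t) * (1 - ?S t)"
      using mult_nonneg_nonneg[OF nonneg \<open>0 \<le> ?S t\<close>] unfolding S by (simp only: algebra_simps)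
    then have "(1 - ?S (Suc t)) * u T \<le> (1 - 2 * N * b t) * (1 - ?S t) * u T"
      using pos[OF T(1)] by (intro mult_right_mono) auto
    also have "\<dots> = (1 - 2 * N * b t) * ((1 - ?S t) * u T)" by (rule mult.assoc)
    also have "\<dots> \<le> (1 - 2 * N * b t) * u t"
      using step \<open>2 * N * b t < 1 / 2\<close> by (intro mult_left_mono) auto
    also have "\<dots> \<le> (1 - N * b t)\<^sup>2 * u t"
      using pos[OF \<open>1 \<le> t\<close>] by (intro mult_right_mono) (auto simp: power2_diff power_mult_distrib)
    also have "\<dots> \<le> u (Suc t)" using recursion[OF \<open>1 \<le> t\<close>] q(1)[OF \<open>1 \<le> t\<close>] by simp
    finally show ?case .
  qed simp
  moreover have "1 / 2 * u T \<le> (1 - ?S t) * u T" for t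
    using half[of t] pos[OF T(1)] by (intro mult_right_mono) auto
  ultimately have "1 / 2 * u T \<le> u t" if "T \<le> t" for t using that order_trans by blast
  then show thesis
    using pos[OF T(1)] by (intro that[of "1 / 2 * u T"]) (auto simp: eventually_sequentially)
qed

section \<open>Scalar projections of the state under complete digraphs\<close>

lemma sum_complete_digraph_edges:
  fixes f :: "'n::finite \<Rightarrow> 'n \<Rightarrow> real"
  shows "(\<Sum>(j, i)\<in>edges complete_digraph. f j i) = (\<Sum>i\<in>UNIV. \<Sum>j\<in>UNIV - {i}. f j i)"
proof -
  have "(\<Sum>i\<in>UNIV. \<Sum>j\<in>UNIV - {i}. f j i) = (\<Sum>(i, j)\<in>(SIGMA i:UNIV. UNIV - {i}). f j i)"
    by (rule sum.Sigma) auto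
  also have "\<dots> = (\<Sum>(j, i)\<in>edges complete_digraph. f j i)"
    by (rule sum.reindex_bij_witness[of _ prod.swap prod.swap]) (auto simp: complete_digraph_def)
  finally show ?thesis ..
qed

text \<open>
  The Laplacian of the complete digraph is \<open>n I - 1 1\<^sup>T\<close>, so the drift of \<open>c \<bullet> x\<close> is
  \<open>(c \<bullet> 1) (1 \<bullet> x) - n (c \<bullet> x)\<close>. It is a multiple of \<open>c \<bullet> x\<close> itself in the two cases that matter:
  it vanishes for \<open>c = 1\<close>, and it is \<open>- n (c \<bullet> x)\<close> when the entries of \<open>c\<close> sum to \<open>0\<close>.
\<close>

lemma inner_state_complete_at:
  fixes c x1 :: "real ^ 'n::finite" and a :: "nat \<Rightarrow> real" and A :: "nat set"
    and w :: "'n \<Rightarrow> 'n \<Rightarrow> nat \<Rightarrow> 'w \<Rightarrow> real"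
  defines "x \<equiv> state a (complete_at A) w x1"
  assumes "1 \<le> t"
  shows "c \<bullet> x (Suc t) \<omega> = c \<bullet> x t \<omega>
    + (if t \<in> A then a t else 0) *
        ((c \<bullet> 1) * (1 \<bullet> x t \<omega>) - real CARD('n) * (c \<bullet> x t \<omega>) + edge_noise (complete_at A) w c t \<omega>)"
proof (cases "t \<in> A")
  case True
  let ?y = "x t \<omega>"
  have nb: "neighbors (complete_at A t) i = UNIV - {i}" for i :: 'n
    using True by (auto simp: neighbors_def complete_at_def complete_digraph_def)
  have "x (Suc t) \<omega> $ i = ?y $ i + a t * (1 \<bullet> ?y - real CARD('n) * ?y $ i + (\<Sum>j\<in>UNIV - {i}. w j i t \<omega>))" for i
  proof -
    have "(\<Sum>j\<in>UNIV - {i}. weight (complete_at A t) i j * (?y $ j - ?y $ i + w j i t \<omega>))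
        = (\<Sum>j\<in>UNIV - {i}. ?y $ j - ?y $ i + w j i t \<omega>)"
      using True by (intro sum.cong) (auto simp: complete_at_def complete_digraph_def)
    also have "\<dots> = (\<Sum>j\<in>UNIV - {i}. ?y $ j - ?y $ i) + (\<Sum>j\<in>UNIV - {i}. w j i t \<omega>)"
      by (rule sum.distrib)
    also have "(\<Sum>j\<in>UNIV - {i}. ?y $ j - ?y $ i) = (\<Sum>j\<in>UNIV. ?y $ j - ?y $ i)"
      by (simp add: sum.remove[of UNIV i "\<lambda>j. ?y $ j - ?y $ i"])
    also have "\<dots> = 1 \<bullet> ?y - real CARD('n) * ?y $ i"
      by (simp add: sum_subtractf inner_vec_def)
    finally show ?thesis using assms(2) by (simp add: x_def nb)
  qed
  then have "c \<bullet> x (Suc t) \<omega> = (\<Sum>i\<in>UNIV. c $ i * (?y $ i + a t * (1 \<bullet> ?y - real CARD('n) * ?y $ i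
      + (\<Sum>j\<in>UNIV - {i}. w j i t \<omega>))))"
    by (simp add: inner_vec_def[of c])
  also have "\<dots> = (\<Sum>i\<in>UNIV. c $ i * ?y $ i) + a t * ((\<Sum>i\<in>UNIV. c $ i) * (1 \<bullet> ?y)
      - real CARD('n) * (\<Sum>i\<in>UNIV. c $ i * ?y $ i) + (\<Sum>i\<in>UNIV. c $ i * (\<Sum>j\<in>UNIV - {i}. w j i t \<omega>)))"
    by (simp add: algebra_simps sum.distrib sum_subtractf sum_distrib_left sum_distrib_right)
  also have "(\<Sum>i\<in>UNIV. c $ i * (\<Sum>j\<in>UNIV - {i}. w j i t \<omega>)) = edge_noise (complete_at A) w c t \<omega>"
    using True by (simp add: edge_noise_def complete_at_def sum_complete_digraph_edges sum_distrib_left)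
  finally show ?thesis using True by (simp add: inner_vec_def)
next
  case False
  then have "x (Suc t) \<omega> = x t \<omega>"
    using assms(2) by (simp add: x_def vec_eq_iff neighbors_def complete_at_def empty_digraph_def)
  with False show ?thesis by simp
qed

declare state.simps(2) [simp del]

lemma state_1: "state a G w x1 1 \<omega> = x1"
  by (simp add: state.simps)

text \<open>
  The hypothesis \<open>drift\<close> says that \<open>c\<close> is a left eigenvector of the Laplacian, for the eigenvalue
  \<open>\<mu>\<close>; then \<open>c \<bullet> x\<close> obeys a scalar recursion of its own. The noise power \<open>q t\<close> is at least
  \<open>v_lo\<close> at active times because the node \<open>i0\<close>, where \<open>c\<close> has modulus \<open>1\<close>, has an incoming edge.
\<close>

lemma second_moment_under_complete_at:
  fixes M :: "'w measure" and c init :: "real ^ 'n::finite" and a :: "nat \<Rightarrow> real"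
    and A :: "nat set" and w :: "'n \<Rightarrow> 'n \<Rightarrow> nat \<Rightarrow> 'w \<Rightarrow> real"
  defines "x \<equiv> state a (complete_at A) w init"
  defines "b \<equiv> \<lambda>t. if t \<in> A then a t else 0"
  assumes "prob_space M" and card: "2 \<le> CARD('n)"
    and noise: "noise_condition M v_lo v_hi (complete_at A) w" and "0 \<le> v_lo"
    and c: "\<bar>c $ i0\<bar> = 1"
    and drift: "\<And>y :: real ^ 'n. (c \<bullet> 1) * (1 \<bullet> y) - real CARD('n) * (c \<bullet> y) = - \<mu> * (c \<bullet> y)"
  shows "\<And>t. 1 \<le> t \<Longrightarrow> square_integrable M (\<lambda>\<omega>. c \<bullet> x t \<omega>)"
    and "\<exists>q. (\<forall>t\<ge>1. 0 \<le> q t \<and> (t \<in> A \<longrightarrow> v_lo \<le> q t)) \<and>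
      (\<forall>t\<ge>1. (\<integral>\<omega>. (c \<bullet> x (Suc t) \<omega>)\<^sup>2 \<partial>M)
        = (1 - \<mu> * b t)\<^sup>2 * (\<integral>\<omega>. (c \<bullet> x t \<omega>)\<^sup>2 \<partial>M) + (b t)\<^sup>2 * q t)"
proof -
  let ?\<xi> = "edge_noise (complete_at A) w c"
  have recursion: "c \<bullet> x (Suc t) \<omega> = (1 - \<mu> * b t) * (c \<bullet> x t \<omega>) + b t * ?\<xi> t \<omega>" if "1 \<le> t" for t \<omega>
  proof -
    have "c \<bullet> x (Suc t) \<omega> = c \<bullet> x t \<omega> + b t * (- \<mu> * (c \<bullet> x t \<omega>) + ?\<xi> t \<omega>)"
      using inner_state_complete_at[OF that, of c a A w init \<omega>] unfolding x_def b_def drift .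
    then show ?thesis by (simp add: algebra_simps)
  qed
  interpret prob_space M by fact
  interpret orthogonal_noise_recursion M "\<lambda>t \<omega>. c \<bullet> x t \<omega>" ?\<xi> "\<lambda>t. 1 - \<mu> * b t" b "c \<bullet> init"
    by unfold_locales
      (auto simp: x_def state_1[simplified] recursion[unfolded x_def] edge_noise_square_integrable[OF noise]
        edge_noise_centered[OF noise] edge_noise_orthogonal[OF noise])
  show "square_integrable M (\<lambda>\<omega>. c \<bullet> x t \<omega>)" if "1 \<le> t" for t
    by (rule z_square_integrable[OF that])
  have "v_lo \<le> (\<integral>\<omega>. (?\<xi> t \<omega>)\<^sup>2 \<partial>M)" if "1 \<le> t" "t \<in> A" for t
  proof -
    obtain j0 where "j0 \<noteq> i0"
      using card by (metis (mono_tags) One_nat_def UNIV_I card_1_singleton_iff is_singletonI'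
          card_le_Suc0_iff_eq finite not_less_eq_eq numeral_2_eq_2)
    have "(c $ i0)\<^sup>2 = (case (j0, i0) of (j, i) \<Rightarrow> (c $ i)\<^sup>2)" by simp
    also have "\<dots> \<le> (\<Sum>(j, i)\<in>edges (complete_at A t). (c $ i)\<^sup>2)"
      using that \<open>j0 \<noteq> i0\<close>
      by (intro member_le_sum) (auto simp: complete_at_def complete_digraph_def)
    also have "(c $ i0)\<^sup>2 = 1" using c by (metis power2_abs one_power2)
    finally have "v_lo * 1 \<le> v_lo * (\<Sum>(j, i)\<in>edges (complete_at A t). (c $ i)\<^sup>2)"
      using \<open>0 \<le> v_lo\<close> by (rule mult_left_mono)
    also have "\<dots> \<le> (\<integral>\<omega>. (?\<xi> t \<omega>)\<^sup>2 \<partial>M)"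
      by (rule edge_noise_second_moment_ge[OF noise that(1)])
    finally show ?thesis by simp
  qed
  then show "\<exists>q. (\<forall>t\<ge>1. 0 \<le> q t \<and> (t \<in> A \<longrightarrow> v_lo \<le> q t)) \<and>
      (\<forall>t\<ge>1. (\<integral>\<omega>. (c \<bullet> x (Suc t) \<omega>)\<^sup>2 \<partial>M)
        = (1 - \<mu> * b t)\<^sup>2 * (\<integral>\<omega>. (c \<bullet> x t \<omega>)\<^sup>2 \<partial>M) + (b t)\<^sup>2 * q t)"
    using second_moment_Suc by (intro exI[of _ "\<lambda>t. \<integral>\<omega>. (?\<xi> t \<omega>)\<^sup>2 \<partial>M"]) auto
qed

section \<open>The two ways to prevent consensus\<close>

text \<open>
  The interaction leaves the sum of the states unchanged, so its second moment is the accumulated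
  noise, of order \<open>\<Sum> (a s)\<^sup>2\<close>. Consensus on a limit of finite variance would keep it bounded.
\<close>

lemma no_consensus_complete_everywhere:
  fixes x1 :: "real ^ 'n::finite" and w :: "'n \<Rightarrow> 'n \<Rightarrow> nat \<Rightarrow> 'w \<Rightarrow> real"
  assumes "prob_space M" and "2 \<le> CARD('n)"
    and "noise_condition M v_lo v_hi (complete_at UNIV) w" and "0 < v_lo"
    and diverges: "\<not> summable (\<lambda>t. (a t)\<^sup>2)"
  shows "\<not> mean_square_consensus M (state a (complete_at UNIV) w x1)"
proof
  let ?x = "state a (complete_at UNIV) w x1"
  let ?u = "\<lambda>t. \<integral>\<omega>. (1 \<bullet> ?x t \<omega>)\<^sup>2 \<partial>M"
  assume consensus: "mean_square_consensus M ?x"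
  have drift: "((1 :: real ^ 'n) \<bullet> 1) * (1 \<bullet> y) - real CARD('n) * (1 \<bullet> y) = - 0 * (1 \<bullet> y)" for y :: "real ^ 'n"
    by (simp add: inner_vec_def)
  note moments = second_moment_under_complete_at[OF assms(1-3) less_imp_le[OF assms(4)] _ drift,
      where init = x1 and a = a]
  obtain q where q: "\<And>t. 1 \<le> t \<Longrightarrow> v_lo \<le> q t"
    and u: "\<And>t. 1 \<le> t \<Longrightarrow> ?u (Suc t) = ?u t + (a t)\<^sup>2 * q t"
    using moments(2) by auto
  have growth: "v_lo * (\<Sum>s\<in>{1..<t}. (a s)\<^sup>2) \<le> ?u t" if "1 \<le> t" for t
    using that
  proof (induction t rule: dec_induct)
    case (step t)
    have "(a t)\<^sup>2 * v_lo \<le> (a t)\<^sup>2 * q t" using q[OF step.hyps(1)] by (simp add: mult_left_mono)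
    with step u[OF step.hyps(1)] show ?case by (simp add: algebra_simps)
  qed simp
  obtain B where B: "eventually (\<lambda>t. ?u t \<le> B) sequentially"
  proof (rule mean_square_consensus_bounds_inner[OF assms(1) consensus, of 1])
    show "square_integrable M (\<lambda>\<omega>. 1 \<bullet> ?x t \<omega>)" if "1 \<le> t" for t
      using moments(1)[OF _ that] by simp
    fix B assume "\<And>\<epsilon>. 0 < \<epsilon> \<Longrightarrow> eventually (\<lambda>t. ?u t \<le> (1 \<bullet> (1 :: real ^ 'n))\<^sup>2 * B + \<epsilon>) sequentially"
    from that[OF this[of 1]] show thesis by simp
  qed simp
  then obtain T where T: "\<And>t. T \<le> t \<Longrightarrow> ?u t \<le> B" by (auto simp: eventually_sequentially)
  have "(\<Sum>t<N. (a (Suc t))\<^sup>2) \<le> B / v_lo" for N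
  proof -
    have "(\<Sum>t<N. (a (Suc t))\<^sup>2) = (\<Sum>t\<in>{1..<Suc N}. (a t)\<^sup>2)"
      using sum.shift_bounds_Suc_ivl[of "\<lambda>t. (a t)\<^sup>2" 0 N] by (metis One_nat_def lessThan_atLeast0)
    also have "\<dots> \<le> (\<Sum>t\<in>{1..<max (Suc N) T}. (a t)\<^sup>2)" by (intro sum_mono2) auto
    also have "\<dots> \<le> B / v_lo"
      using order_trans[OF growth[of "max (Suc N) T"] T[of "max (Suc N) T"]] \<open>0 < v_lo\<close>
      by (simp add: field_simps)
    finally show ?thesis .
  qed
  then have "summable (\<lambda>t. (a (Suc t))\<^sup>2)"
    by (intro summableI_nonneg_bounded[of _ "B / v_lo"]) auto
  then have "summable (\<lambda>t. (a t)\<^sup>2)" using summable_Suc_iff[of "\<lambda>t. (a t)\<^sup>2"] by blast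
  with diverges show False ..
qed

text \<open>
  For two nodes with different initial states, the difference of their states is a projection with
  \<open>c \<bullet> 1 = 0\<close>. Its second moment tends to \<open>0\<close> under consensus, whereas a summable total gain keeps
  it away from \<open>0\<close>.
\<close>

lemma no_consensus_summable_gains:
  fixes x1 :: "real ^ 'n::finite" and w :: "'n \<Rightarrow> 'n \<Rightarrow> nat \<Rightarrow> 'w \<Rightarrow> real"
  assumes "prob_space M" and "2 \<le> CARD('n)"
    and "noise_condition M v_lo v_hi (complete_at A) w" and "0 < v_lo"
    and "\<not> consensus_state x1" and a: "\<And>t. 1 \<le> t \<Longrightarrow> 0 \<le> a t"
    and summable: "summable (\<lambda>t. if t \<in> A then a t else 0)"
  shows "\<not> mean_square_consensus M (state a (complete_at A) w x1)"
proof
  let ?x = "state a (complete_at A) w x1"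
  let ?b = "\<lambda>t. if t \<in> A then a t else 0"
  assume consensus: "mean_square_consensus M ?x"
  interpret prob_space M by fact
  from assms(5) obtain i j where ij: "x1 $ i \<noteq> x1 $ j" by (auto simp: consensus_state_def)
  define c :: "real ^ 'n" where "c = axis i 1 - axis j 1"
  have ci: "\<bar>c $ i\<bar> = 1" using ij by (auto simp: c_def axis_def)
  then have "c \<noteq> 0" by auto
  have c1: "c \<bullet> 1 = 0" by (simp add: c_def inner_diff_left inner_axis')
  have drift: "(c \<bullet> 1) * (1 \<bullet> y) - real CARD('n) * (c \<bullet> y) = - real CARD('n) * (c \<bullet> y)"
    for y :: "real ^ 'n" by (simp add: c1)
  let ?u = "\<lambda>t. \<integral>\<omega>. (c \<bullet> ?x t \<omega>)\<^sup>2 \<partial>M"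
  note moments = second_moment_under_complete_at[OF assms(1-3) less_imp_le[OF assms(4)] ci drift,
      where init = x1 and a = a]
  obtain q where q: "\<And>t. 1 \<le> t \<Longrightarrow> 0 \<le> q t" "\<And>t. 1 \<le> t \<Longrightarrow> t \<in> A \<Longrightarrow> v_lo \<le> q t"
    and u: "\<And>t. 1 \<le> t \<Longrightarrow> ?u (Suc t) = (1 - real CARD('n) * ?b t)\<^sup>2 * ?u t + (?b t)\<^sup>2 * q t"
    using moments(2) by blast
  have "c \<bullet> x1 = x1 $ i - x1 $ j" by (simp add: c_def inner_diff_left inner_axis')
  then have u1: "0 < ?u 1" using ij by (simp add: state_1[simplified] prob_space)
  have q_pos: "0 < q t" if "1 \<le> t" "?b t \<noteq> 0" for t
    using that q(2)[of t] \<open>0 < v_lo\<close> by (auto split: if_splits)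
  have b_nonneg: "0 \<le> ?b t" if "1 \<le> t" for t using a that by simp
  obtain \<epsilon> where "0 < \<epsilon>" and below: "eventually (\<lambda>t. \<epsilon> \<le> ?u t) sequentially"
    by (rule damped_recursion_bounded_below[of ?u "real CARD('n)" ?b q,
          OF u1 of_nat_0_le_iff b_nonneg summable q(1) q_pos u]) blast
  obtain B where "\<And>\<epsilon>. 0 < \<epsilon> \<Longrightarrow> eventually (\<lambda>t. ?u t \<le> (c \<bullet> 1)\<^sup>2 * B + \<epsilon>) sequentially"
    using mean_square_consensus_bounds_inner[OF assms(1) consensus \<open>c \<noteq> 0\<close> moments(1)] by blast
  from this[of "\<epsilon> / 2"] have "eventually (\<lambda>t. ?u t \<le> \<epsilon> / 2) sequentially"
    using \<open>0 < \<epsilon>\<close> by (simp add: c1)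
  with below have "eventually (\<lambda>t. False) sequentially"
    by eventually_elim (use \<open>0 < \<epsilon>\<close> in linarith)
  then show False by simp
qed

text \<open>
  Capping the exponent at \<open>1\<close> keeps the windows short enough for their successive starting times to
  at most double, and short windows for the smaller exponent are admissible for the larger one.
\<close>

theorem theorem3p2:
  fixes M :: "'w measure"
    and a_max :: real
    and W :: "(nat \<Rightarrow> 'n::finite wdigraph) \<Rightarrow> 'n \<Rightarrow> 'n \<Rightarrow> nat \<Rightarrow> 'w \<Rightarrow> real"
    and \<delta>' :: real
    and x1 :: "real ^ 'n"
    and a :: "nat \<Rightarrow> real"
  assumes "prob_space M"
    and "CARD('n) \<ge> 2"
    and "a_max \<ge> 1"
    and "uniform_noise_condition M a_max W"
    and "\<delta>' > 1 / 2"
    and "\<not> consensus_state x1"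
    and "\<And>t. t \<ge> 1 \<Longrightarrow> a t \<ge> 0"
  shows "\<exists>G. topology_sequence a_max G \<and>
           extensible_joint_connectivity \<delta>' G \<and>
           (\<forall>t\<ge>1. balanced (G t)) \<and>
           \<not> mean_square_consensus M (state a G (W G) x1)"
proof -
  define s where "s = min \<delta>' 1"
  have s: "1 / 2 < s" "s \<le> 1" "s \<le> \<delta>'" using assms(5) by (auto simp: s_def)
  obtain v_lo v_hi where "0 < v_lo"
    and noise: "\<And>A. noise_condition M v_lo v_hi (complete_at A) (W (complete_at A))"
    using assms(4) topology_sequence_complete_at[OF assms(3)]
    unfolding uniform_noise_condition_def by metis
  obtain A where hit: "\<And>k. \<exists>t\<in>A. window_start s k \<le> t \<and> t < window_start s (Suc k)"
    and no_consensus: "\<not> mean_square_consensus M (state a (complete_at A) (W (complete_at A)) x1)"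
  proof (cases "summable (\<lambda>t. (a t)\<^sup>2)")
    case True
    have "\<exists>A. (\<forall>k. \<exists>t\<in>A. window_start s k \<le> t \<and> t < window_start s (Suc k)) \<and>
        summable (\<lambda>t. if t \<in> A then a t else 0)"
      by (rule summable_gains_at_hitting_times) (fact s assms(7) True)+
    then obtain A where hit: "\<And>k. \<exists>t\<in>A. window_start s k \<le> t \<and> t < window_start s (Suc k)"
      and summable: "summable (\<lambda>t. if t \<in> A then a t else 0)"
      by (elim exE conjE) iprover
    have "\<not> mean_square_consensus M (state a (complete_at A) (W (complete_at A)) x1)"
      by (rule no_consensus_summable_gains) (fact assms noise \<open>0 < v_lo\<close> summable)+
    with hit show thesis by (rule that)
  next
    case False
    have "\<exists>t\<in>UNIV. window_start s k \<le> t \<and> t < window_start s (Suc k)" for k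
      using strict_monoD[OF strict_mono_window_start, of k "Suc k" s] by auto
    moreover have "\<not> mean_square_consensus M (state a (complete_at UNIV) (W (complete_at UNIV)) x1)"
      by (rule no_consensus_complete_everywhere) (fact assms noise \<open>0 < v_lo\<close> False)+
    ultimately show thesis by (rule that)
  qed
  show ?thesis
  proof (intro exI[of _ "complete_at A"] conjI allI impI)
    show "extensible_joint_connectivity \<delta>' (complete_at A :: nat \<Rightarrow> 'n wdigraph)"
      using s by (intro extensible_joint_connectivity_complete_at[OF _ _ hit]) auto
  qed (use topology_sequence_complete_at[OF assms(3)] balanced_complete_at no_consensus in auto)
qed

end
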